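(* Let $d\ge 1$, $\Omega=(-\pi,\pi)^d$ with periodic boundary conditions, and let $\lambda\in[0,1]$. For the heat equation $\partial_t u=\lambda\Delta u+(1-\lambda)\Delta u$ on $\Omega$ consider, with time step size $\tau>0$, the Lawson2a scheme $$\begin{aligned} U &= \mathrm{e}^{\frac{\tau}{2}\lambda\Delta}\left(u^n+\tfrac{\tau}{2}(1-\lambda)\Delta u^n\right),\\ u^{n+1} &= \mathrm{e}^{\tau\lambda\Delta}u^n+\tau\,\mathrm{e}^{\frac{\tau}{2}\lambda\Delta}(1-\lambda)\Delta U, \end{aligned}$$ and the Lawson2b scheme $$\begin{aligned} U &= \mathrm{e}^{\tau\lambda\Delta}\left(u^n+\tau(1-\lambda)\Delta u^n\right),\\ u^{n+1} &= \mathrm{e}^{\tau\lambda\Delta}u^n+\frac{\tau}{2}\mathrm{e}^{\tau\lambda\Delta}(1-\lambda)\Delta u^n+\frac{\tau}{2}(1-\lambda)\Delta U. \end{aligned}$$ If $\lambda\ge 0.301$, then both schemes are unconditionally stable.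
   Context: Functions of $\Delta$ act on periodic functions as Fourier multipliers, $\Delta$ acting on the $\boldsymbol k$-th Fourier mode ($\boldsymbol k\in\mathbb{Z}^d$) as multiplication by $-k^2$, where $k^2=\sum_{\mu=1}^d k_\mu^2$. Each scheme therefore acts on each Fourier coefficient $\hat u^n_{\boldsymbol k}$ of $u^n$ by $\hat u^{n+1}_{\boldsymbol k}=\Phi(z,\lambda)\,\hat u^n_{\boldsymbol k}$ with $z=-\tau k^2$, where the stability function $\Phi(z,\lambda)$ of the scheme is the scalar amplification factor obtained by formally replacing every occurrence of $\tau\Delta$ in the scheme by the real number $z$ and eliminating $U$. A scheme (with parameter $\lambda$) is called unconditionally stable if $|\Phi(z,\lambda)|\le 1$ for all $z\in(-\infty,0]$. *)

theory Defs
  imports "HOL-Analysis.Analysis"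
begin

section \<open>Periodic functions on the torus and functions of the Laplacian\<close>

definition Omega :: "(real ^ 'd) set" where
  "Omega = {x. \<forall>i. - pi < x $ i \<and> x $ i < pi}"

definition periodic_function :: "(real ^ 'd \<Rightarrow> complex) \<Rightarrow> bool" where
  "periodic_function u \<longleftrightarrow>
     u absolutely_integrable_on Omega \<and>
     (\<forall>x i. u (x + (2 * pi) *\<^sub>R axis i 1) = u x)"

definition fourier_coeff :: "(real ^ 'd \<Rightarrow> complex) \<Rightarrow> int ^ 'd \<Rightarrow> complex" where
  "fourier_coeff u k =
     integral Omega (\<lambda>x. cis (- (\<Sum>i\<in>UNIV. of_int (k $ i) * x $ i)) * u x)
       / of_real ((2 * pi) ^ CARD('d))"

definition mode_sq :: "int ^ 'd \<Rightarrow> real" where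
  "mode_sq k = (\<Sum>i\<in>UNIV. (of_int (k $ i))\<^sup>2)"

text \<open>\<open>laplacian_fun m u v\<close> says \<open>v = m(\<Delta>) u\<close>.  This is a relation because \<open>m(\<Delta>)\<close> may be
  unbounded (as for \<open>\<Delta>\<close> itself) and because \<open>v\<close> is determined only almost everywhere.\<close>

definition laplacian_fun ::
    "(real \<Rightarrow> real) \<Rightarrow> (real ^ 'd \<Rightarrow> complex) \<Rightarrow> (real ^ 'd \<Rightarrow> complex) \<Rightarrow> bool" where
  "laplacian_fun m u v \<longleftrightarrow>
     periodic_function u \<and> periodic_function v \<and>
     (\<forall>k. fourier_coeff v k = of_real (m (- mode_sq k)) * fourier_coeff u k)"

section \<open>The schemes\<close>

text \<open>In both schemes \<open>Du\<close> and \<open>DU\<close> stand for \<open>\<Delta>u\<close> and \<open>\<Delta>U\<close>, and \<open>A\<close>, \<open>B\<close> for the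
  results of applying the exponentials in the formula for the new iterate \<open>u'\<close>.\<close>

definition lawson2a ::
    "real \<Rightarrow> real \<Rightarrow> (real ^ 'd \<Rightarrow> complex) \<Rightarrow> (real ^ 'd \<Rightarrow> complex) \<Rightarrow> bool" where
  "lawson2a \<tau> lam u u' \<longleftrightarrow>
     (\<exists>Du U DU A B.
        laplacian_fun (\<lambda>\<Delta>. \<Delta>) u Du \<and>
        laplacian_fun (\<lambda>\<Delta>. exp (\<tau> / 2 * lam * \<Delta>))
          (\<lambda>x. u x + (\<tau> / 2 * (1 - lam)) *\<^sub>R Du x) U \<and>
        laplacian_fun (\<lambda>\<Delta>. \<Delta>) U DU \<and>
        laplacian_fun (\<lambda>\<Delta>. exp (\<tau> * lam * \<Delta>)) u A \<and>
        laplacian_fun (\<lambda>\<Delta>. exp (\<tau> / 2 * lam * \<Delta>)) (\<lambda>x. (1 - lam) *\<^sub>R DU x) B \<and>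
        (\<forall>x. u' x = A x + \<tau> *\<^sub>R B x))"

definition lawson2b ::
    "real \<Rightarrow> real \<Rightarrow> (real ^ 'd \<Rightarrow> complex) \<Rightarrow> (real ^ 'd \<Rightarrow> complex) \<Rightarrow> bool" where
  "lawson2b \<tau> lam u u' \<longleftrightarrow>
     (\<exists>Du U DU A B.
        laplacian_fun (\<lambda>\<Delta>. \<Delta>) u Du \<and>
        laplacian_fun (\<lambda>\<Delta>. exp (\<tau> * lam * \<Delta>))
          (\<lambda>x. u x + (\<tau> * (1 - lam)) *\<^sub>R Du x) U \<and>
        laplacian_fun (\<lambda>\<Delta>. \<Delta>) U DU \<and>
        laplacian_fun (\<lambda>\<Delta>. exp (\<tau> * lam * \<Delta>)) u A \<and>
        laplacian_fun (\<lambda>\<Delta>. exp (\<tau> * lam * \<Delta>)) (\<lambda>x. (1 - lam) *\<^sub>R Du x) B \<and>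
        (\<forall>x. u' x = A x + (\<tau> / 2) *\<^sub>R B x + (\<tau> / 2 * (1 - lam)) *\<^sub>R DU x))"

section \<open>Stability\<close>

text \<open>The stability functions are the schemes for \<open>u\<^sup>n = 1\<close> with \<open>\<tau>\<Delta>\<close> replaced by the real
  number \<open>z\<close>.\<close>

definition Phi_lawson2a :: "real \<Rightarrow> real \<Rightarrow> real" where
  "Phi_lawson2a z lam =
     (let U = exp (z / 2 * lam) * (1 + z / 2 * (1 - lam))
      in exp (z * lam) + exp (z / 2 * lam) * (1 - lam) * z * U)"

definition Phi_lawson2b :: "real \<Rightarrow> real \<Rightarrow> real" where
  "Phi_lawson2b z lam =
     (let U = exp (z * lam) * (1 + z * (1 - lam))
      in exp (z * lam) + 1 / 2 * exp (z * lam) * (1 - lam) * z + 1 / 2 * (1 - lam) * z * U)"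

text \<open>For the scheme with parameter \<open>lam\<close>, \<open>\<Phi>(-\<tau>k\<^sup>2, lam)\<close> is the amplification factor of
  the \<open>k\<close>-th Fourier mode.\<close>

definition has_stability_function ::
    "(real \<Rightarrow> real \<Rightarrow> (real ^ 'd \<Rightarrow> complex) \<Rightarrow> (real ^ 'd \<Rightarrow> complex) \<Rightarrow> bool)
      \<Rightarrow> (real \<Rightarrow> real \<Rightarrow> real) \<Rightarrow> real \<Rightarrow> bool" where
  "has_stability_function scheme \<Phi> lam \<longleftrightarrow>
     (\<forall>\<tau>>0. \<forall>u u'. scheme \<tau> lam u u' \<longrightarrow>
        (\<forall>k. fourier_coeff u' k = of_real (\<Phi> (- \<tau> * mode_sq k) lam) * fourier_coeff u k))"

definition unconditionally_stable :: "(real \<Rightarrow> real \<Rightarrow> real) \<Rightarrow> real \<Rightarrow> bool" where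
  "unconditionally_stable \<Phi> lam \<longleftrightarrow> (\<forall>z\<in>{..0}. \<bar>\<Phi> z lam\<bar> \<le> 1)"

end

theory Submission
  imports Defs
begin

text \<open>On Fourier coefficients both schemes multiply by
  \<open>exp (\<lambda> z) * (1 - y + y\<^sup>2 / 2)\<close> with \<open>y = - (1 - \<lambda>) z \<ge> 0\<close>. This factor is positive and, for \<open>\<lambda> < 1\<close>, at
  most \<open>1\<close> iff \<open>1 - y + y\<^sup>2 / 2 \<le> exp (r y)\<close>, where \<open>r = \<lambda> / (1 - \<lambda>) > 0.4306\<close>. The critical \<open>y\<close>
  is close to \<open>5.4\<close>; near and beyond it the inequality follows by expanding the exponential to
  third order about \<open>5.4\<close>, and for small \<open>y\<close> the tangent at \<open>0\<close> is enough.\<close>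

lemma Omega_eq_box: "(Omega :: (real ^ 'd) set) = box (\<chi> i. - pi) (\<chi> i. pi)"
  by (auto simp: Omega_def mem_box_cart)

text \<open>The exponential factor is continuous and bounded by 1. The result supplies the
  integrability under which the integral in \<open>fourier_coeff\<close> splits over sums.\<close>

lemma absolutely_integrable_cis_mult:
  fixes u :: "real ^ 'd \<Rightarrow> complex"
  assumes "u absolutely_integrable_on Omega"
  shows "(\<lambda>x. cis (- (\<Sum>i\<in>UNIV. of_int (k $ i) * x $ i)) * u x) absolutely_integrable_on Omega"
proof (rule absolutely_integrable_bounded_measurable_product[where h = "(*)"])
  show "bilinear ((*) :: complex \<Rightarrow> complex \<Rightarrow> complex)"
    by (simp add: bilinear_conv_bounded_bilinear bounded_bilinear_mult)
  show "Omega \<in> sets (lebesgue :: (real ^ 'd) measure)"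
    by (simp add: Omega_eq_box)
  show "(\<lambda>x :: real ^ 'd. cis (- (\<Sum>i\<in>UNIV. of_int (k $ i) * x $ i)))
          \<in> borel_measurable (lebesgue_on Omega)"
    by (intro continuous_imp_measurable_on_sets_lebesgue continuous_intros)
      (simp add: Omega_eq_box)
  show "bounded ((\<lambda>x :: real ^ 'd. cis (- (\<Sum>i\<in>UNIV. of_int (k $ i) * x $ i))) ` Omega)"
    by (auto simp: bounded_iff intro!: exI[of _ 1])
qed (use assms in auto)

lemma fourier_coeff_add:
  assumes "u absolutely_integrable_on Omega" "v absolutely_integrable_on Omega"
  shows "fourier_coeff (\<lambda>x. u x + v x) k = fourier_coeff u k + fourier_coeff v k"
  using assms[THEN absolutely_integrable_cis_mult[of _ k], THEN set_lebesgue_integral_eq_integral(1)]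
  by (simp add: fourier_coeff_def distrib_left integral_add add_divide_distrib)

lemma fourier_coeff_scaleR:
  "fourier_coeff (\<lambda>x. c *\<^sub>R u x) k = of_real c * fourier_coeff u k"
proof -
  have "(\<lambda>x. cis (- (\<Sum>i\<in>UNIV. of_int (k $ i) * x $ i)) * c *\<^sub>R u x) =
      (\<lambda>x. c *\<^sub>R (cis (- (\<Sum>i\<in>UNIV. of_int (k $ i) * x $ i)) * u x))"
    by simp
  then show ?thesis
    by (simp only: fourier_coeff_def integral_cmul) (simp add: scaleR_conv_of_real)
qed

lemma fourier_coeff_add_scaleR:
  assumes "u absolutely_integrable_on Omega" "v absolutely_integrable_on Omega"
  shows "fourier_coeff (\<lambda>x. u x + c *\<^sub>R v x) k = fourier_coeff u k + of_real c * fourier_coeff v k"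
  by (simp add: assms fourier_coeff_add fourier_coeff_scaleR)

lemma laplacian_funD:
  assumes "laplacian_fun m u v"
  shows "u absolutely_integrable_on Omega" "v absolutely_integrable_on Omega"
    "fourier_coeff v k = of_real (m (- mode_sq k)) * fourier_coeff u k"
  using assms by (simp_all add: laplacian_fun_def periodic_function_def)

lemma has_stability_function_lawson2a:
  "has_stability_function
     (lawson2a :: real \<Rightarrow> real \<Rightarrow> (real ^ 'd \<Rightarrow> complex) \<Rightarrow> (real ^ 'd \<Rightarrow> complex) \<Rightarrow> bool)
     Phi_lawson2a lam"
  unfolding has_stability_function_def
proof (intro allI impI)
  fix \<tau> :: real and u u' :: "real ^ 'd \<Rightarrow> complex" and k :: "int ^ 'd"
  assume "lawson2a \<tau> lam u u'"
  then obtain Du U DU A B where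
    Du: "laplacian_fun (\<lambda>\<Delta>. \<Delta>) u Du" and
    U: "laplacian_fun (\<lambda>\<Delta>. exp (\<tau> / 2 * lam * \<Delta>))
          (\<lambda>x. u x + (\<tau> / 2 * (1 - lam)) *\<^sub>R Du x) U" and
    DU: "laplacian_fun (\<lambda>\<Delta>. \<Delta>) U DU" and
    A: "laplacian_fun (\<lambda>\<Delta>. exp (\<tau> * lam * \<Delta>)) u A" and
    B: "laplacian_fun (\<lambda>\<Delta>. exp (\<tau> / 2 * lam * \<Delta>)) (\<lambda>x. (1 - lam) *\<^sub>R DU x) B" and
    u': "u' = (\<lambda>x. A x + \<tau> *\<^sub>R B x)"
    unfolding lawson2a_def by blast
  \<comment> \<open>The rewrites run through the scheme backwards, from \<open>u'\<close> over
    \<open>A\<close>, \<open>B\<close>, \<open>DU\<close> and \<open>U\<close> down to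
    \<open>Du\<close>, until only a scalar multiple of \<open>fourier_coeff u k\<close> is
    left.\<close>
  show "fourier_coeff u' k = of_real (Phi_lawson2a (- \<tau> * mode_sq k) lam) * fourier_coeff u k"
    unfolding u' fourier_coeff_add_scaleR[OF A[THEN laplacian_funD(2)] B[THEN laplacian_funD(2)]]
      A[THEN laplacian_funD(3)] B[THEN laplacian_funD(3)] fourier_coeff_scaleR
      DU[THEN laplacian_funD(3)] U[THEN laplacian_funD(3)]
      fourier_coeff_add_scaleR[OF Du[THEN laplacian_funD(1)] Du[THEN laplacian_funD(2)]]
      Du[THEN laplacian_funD(3)]
    by (simp add: Phi_lawson2a_def Let_def field_simps)
qed

lemma has_stability_function_lawson2b:
  "has_stability_function
     (lawson2b :: real \<Rightarrow> real \<Rightarrow> (real ^ 'd \<Rightarrow> complex) \<Rightarrow> (real ^ 'd \<Rightarrow> complex) \<Rightarrow> bool)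
     Phi_lawson2b lam"
  unfolding has_stability_function_def
proof (intro allI impI)
  fix \<tau> :: real and u u' :: "real ^ 'd \<Rightarrow> complex" and k :: "int ^ 'd"
  assume "lawson2b \<tau> lam u u'"
  then obtain Du U DU A B where
    Du: "laplacian_fun (\<lambda>\<Delta>. \<Delta>) u Du" and
    U: "laplacian_fun (\<lambda>\<Delta>. exp (\<tau> * lam * \<Delta>))
          (\<lambda>x. u x + (\<tau> * (1 - lam)) *\<^sub>R Du x) U" and
    DU: "laplacian_fun (\<lambda>\<Delta>. \<Delta>) U DU" and
    A: "laplacian_fun (\<lambda>\<Delta>. exp (\<tau> * lam * \<Delta>)) u A" and
    B: "laplacian_fun (\<lambda>\<Delta>. exp (\<tau> * lam * \<Delta>)) (\<lambda>x. (1 - lam) *\<^sub>R Du x) B" and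
    u': "u' = (\<lambda>x. A x + (\<tau> / 2) *\<^sub>R B x + (\<tau> / 2 * (1 - lam)) *\<^sub>R DU x)"
    unfolding lawson2b_def by blast
  \<comment> \<open>The update has three terms, so the two-term sum rule is used twice and the inner
    sum must itself be integrable.\<close>
  have AB: "(\<lambda>x. A x + (\<tau> / 2) *\<^sub>R B x) absolutely_integrable_on Omega"
    using A[THEN laplacian_funD(2)] B[THEN laplacian_funD(2)] by auto
  show "fourier_coeff u' k = of_real (Phi_lawson2b (- \<tau> * mode_sq k) lam) * fourier_coeff u k"
    unfolding u' fourier_coeff_add_scaleR[OF AB DU[THEN laplacian_funD(2)]]
      fourier_coeff_add_scaleR[OF A[THEN laplacian_funD(2)] B[THEN laplacian_funD(2)]]
      A[THEN laplacian_funD(3)] B[THEN laplacian_funD(3)] fourier_coeff_scaleR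
      DU[THEN laplacian_funD(3)] U[THEN laplacian_funD(3)]
      fourier_coeff_add_scaleR[OF Du[THEN laplacian_funD(1)] Du[THEN laplacian_funD(2)]]
      Du[THEN laplacian_funD(3)]
    by (simp add: Phi_lawson2b_def Let_def field_simps)
qed

text \<open>The Lagrange remainder has even order 4, so it is nonnegative for negative
  \<open>x\<close> too; the expansion about 5.4 relies on this to its left.\<close>

lemma exp_ge_Taylor_cubic: "1 + x + x\<^sup>2 / 2 + x ^ 3 / 6 \<le> exp x" for x :: real
proof -
  obtain t where "exp x = (\<Sum>m<4. x ^ m / fact m) + exp t / fact 4 * x ^ 4"
    using Maclaurin_exp_le[of x 4] by blast
  moreover have "(\<Sum>m<4. x ^ m / fact m) = 1 + x + x\<^sup>2 / 2 + x ^ 3 / 6"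
    by (simp add: eval_nat_numeral)
  moreover have "exp t / fact 4 * x ^ 4 \<ge> 0"
    by simp
  ultimately show ?thesis
    by linarith
qed

text \<open>The rate is 0.301 / 0.699 = 0.43061... rounded down. The margin is thin: at
  \<open>y = 5.4\<close> the left side is 10.18 and the right side about 10.23.\<close>

lemma quadratic_le_exp:
  fixes y :: real
  assumes "y \<ge> 0"
  shows "1 - y + y\<^sup>2 / 2 \<le> exp (0.4306 * y)"
proof (cases "y \<le> 2.8")
  case True
  have "y * y \<le> 2.8 * y"
    using True assms by (rule mult_right_mono)
  then have "1 - y + y\<^sup>2 / 2 \<le> 1 + 0.4306 * y"
    using assms by (simp add: power2_eq_square)
  also have "\<dots> \<le> exp (0.4306 * y)"
    by (rule exp_ge_add_one_self)
  finally show ?thesis .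
next
  case False
  define s t where "s = y - 5.4" and "t = 0.4306 * s"
  have s: "s > - 2.6"
    using False by (simp add: s_def)
  define c :: real where "c = 0.4306 * 5.4"
  \<comment> \<open>The cubic at \<open>c\<close> itself, about 8.1, is too small; at
    \<open>c / 8\<close> it is accurate enough to survive the eighth power.\<close>
  have "10.2 \<le> (1 + c / 8 + (c / 8)\<^sup>2 / 2 + (c / 8) ^ 3 / 6) ^ 8"
    by (simp add: c_def power_divide eval_nat_numeral field_simps)
  also have "\<dots> \<le> exp (c / 8) ^ 8"
    by (rule power_mono[OF exp_ge_Taylor_cubic]) (simp add: c_def)
  also have "\<dots> = exp c"
    by (simp flip: exp_of_nat_mult)
  finally have exp_c: "10.2 \<le> exp c" .
  have y: "y = s + 27 / 5"
    by (simp add: s_def)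
  \<comment> \<open>This and the next two facts certify the cubic in \<open>s\<close> below: part of
    its square term controls \<open>s ^ 3\<close> for negative \<open>s\<close>, and
    \<open>(s - 0.1)\<^sup>2\<close> absorbs the slope, which is tiny because 5.4 nearly minimizes
    the gap. The constant 1 / 50 is 10.2 - 10.18.\<close>
  have "0 \<le> s\<^sup>2 * (s + 2.6)"
    using s by simp
  then have "0 \<le> s ^ 3 + 13 / 5 * s\<^sup>2"
    by (simp add: power2_eq_square power3_eq_cube algebra_simps)
  moreover have "0 \<le> (s - 0.1)\<^sup>2"
    by simp
  then have "0 \<le> s\<^sup>2 - 1 / 5 * s + 1 / 100"
    by (simp add: power2_eq_square algebra_simps)
  moreover have "0 \<le> s\<^sup>2"
    by simp
  ultimately have "0 \<le> 1 / 50 - 197 / 25000 * s + 111405859 / 250000000 * s\<^sup>2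
      + 169660604809 / 1250000000000 * s ^ 3"
    by linarith
  also have "\<dots> = 10.2 * (1 + t + t\<^sup>2 / 2 + t ^ 3 / 6) - (1 - y + y\<^sup>2 / 2)"
    unfolding t_def y by (simp add: power2_eq_square power3_eq_cube field_simps)
  finally have "1 - y + y\<^sup>2 / 2 \<le> 10.2 * (1 + t + t\<^sup>2 / 2 + t ^ 3 / 6)"
    by simp
  also have "\<dots> \<le> 10.2 * exp t"
    by (rule mult_left_mono[OF exp_ge_Taylor_cubic]) simp
  also have "\<dots> \<le> exp c * exp t"
    using exp_c by simp
  also have "\<dots> = exp (0.4306 * y)"
    by (simp add: c_def t_def y distrib_left flip: exp_add)
  finally show ?thesis .
qed

lemma lawson2_factor_le_one:
  fixes lam z :: real
  assumes "lam \<in> {0.301..1}" "z \<le> 0"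
  shows "\<bar>exp (z * lam) * (1 + (1 - lam) * z + ((1 - lam) * z)\<^sup>2 / 2)\<bar> \<le> 1"
proof -
  define y where "y = - ((1 - lam) * z)"
  have y: "y \<ge> 0"
    using assms by (simp add: y_def mult_nonneg_nonpos)
  have "0 \<le> (1 + (1 - y)\<^sup>2) / 2"
    by simp
  then have nonneg: "0 \<le> 1 - y + y\<^sup>2 / 2"
    by (simp add: power2_eq_square algebra_simps add_divide_distrib)
  \<comment> \<open>This is \<open>r >= 0.4306\<close> cleared of its denominator, so
    \<open>lam = 1\<close> is included; it rests on 1.4306 * 0.301 > 0.4306.\<close>
  have "z * (lam - 0.4306 * (1 - lam)) \<le> 0"
    using assms by (intro mult_nonpos_nonneg) auto
  then have "0.4306 * y \<le> - (z * lam)"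
    by (simp add: y_def algebra_simps)
  then have "1 - y + y\<^sup>2 / 2 \<le> exp (- (z * lam))"
    using quadratic_le_exp[OF y] by (meson exp_le_cancel_iff order_trans)
  then have "exp (z * lam) * (1 - y + y\<^sup>2 / 2) \<le> exp (z * lam) * exp (- (z * lam))"
    by simp
  also have "\<dots> = 1"
    by (simp flip: exp_add)
  finally show ?thesis
    using nonneg by (simp add: y_def)
qed

text \<open>The half-step exponentials of the two stages multiply to a full one, which yields the
  same function as for Lawson2b, so one bound serves both schemes.\<close>

lemma Phi_lawson2a_eq:
  "Phi_lawson2a z lam = exp (z * lam) * (1 + (1 - lam) * z + ((1 - lam) * z)\<^sup>2 / 2)"
proof -
  have "exp (z * lam) = exp (z / 2 * lam) * exp (z / 2 * lam)"
    by (simp flip: exp_add)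
  then show ?thesis
    by (simp add: Phi_lawson2a_def Let_def power2_eq_square field_simps)
qed

lemma Phi_lawson2b_eq:
  "Phi_lawson2b z lam = exp (z * lam) * (1 + (1 - lam) * z + ((1 - lam) * z)\<^sup>2 / 2)"
  by (simp add: Phi_lawson2b_def Let_def power2_eq_square field_simps)

theorem theorem2p6:
  fixes lam :: real
  assumes "lam \<in> {0..1}"
    and "lam \<ge> 0.301"
  shows "has_stability_function
           (lawson2a :: real \<Rightarrow> real \<Rightarrow> (real ^ 'd \<Rightarrow> complex) \<Rightarrow> (real ^ 'd \<Rightarrow> complex) \<Rightarrow> bool)
           Phi_lawson2a lam
         \<and> unconditionally_stable Phi_lawson2a lam
         \<and> has_stability_function
           (lawson2b :: real \<Rightarrow> real \<Rightarrow> (real ^ 'd \<Rightarrow> complex) \<Rightarrow> (real ^ 'd \<Rightarrow> complex) \<Rightarrow> bool)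
           Phi_lawson2b lam
         \<and> unconditionally_stable Phi_lawson2b lam"
  using assms
  by (simp add: has_stability_function_lawson2a has_stability_function_lawson2b
      unconditionally_stable_def Phi_lawson2a_eq Phi_lawson2b_eq lawson2_factor_le_one)

end
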